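(* For all integers $s\ge 1$ and $t\ge 2$, $$\chi_s(W(s,t))=t+2(s-1).$$
   Context: Graphs are finite, simple and undirected. For positive integers $s,t$ the graph $W(s,t)$ has vertex set consisting of all sequences $(x_1,\dots,x_t)$ with $x_i\in\{0,1,\dots,s\}$ for all $i$, such that there is exactly one index $i$ with $x_i=0$ and at least one index $j$ with $x_j=1$. Two vertices $(x_1,\dots,x_t)$ and $(y_1,\dots,y_t)$ are adjacent if and only if for every $i$ either $|x_i-y_i|=1$ or $x_i=y_i=s$. For a graph $G$ and a positive integer $r$, the $r$-fold chromatic number ($r$-th multichromatic number) $\chi_r(G)$ is the minimum $n$ such that one can assign to each vertex of $G$ a set of exactly $r$ distinct colors from $\{1,\dots,n\}$ in such a way that adjacent vertices receive disjoint sets. (Equivalently, $G$ admits a homomorphism to the Kneser graph whose vertices are the $r$-element subsets of $\{1,\dots,n\}$, two being adjacent if and only if they are disjoint.) *)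

theory Defs
  imports "Graph_Theory.Pair_Digraph"
begin

text \<open>
  A finite simple undirected graph is a \<^locale>\<open>pair_graph\<close>: its arc set is a finite, symmetric,
  irreflexive relation on a finite vertex set.
\<close>

text \<open>
  A sequence of length \<open>t\<close> is a list, so its entries are indexed by \<open>0, ..., t - 1\<close>. The entries
  are cast to \<^typ>\<open>int\<close> in the adjacency condition because subtraction on \<^typ>\<open>nat\<close> truncates.
\<close>

definition W_verts :: "nat \<Rightarrow> nat \<Rightarrow> nat list set" where
  "W_verts s t = {x. length x = t \<and> (\<forall>i<t. x ! i \<in> {0..s}) \<and>
     (\<exists>!i. i < t \<and> x ! i = 0) \<and> (\<exists>j<t. x ! j = 1)}"

definition W_adj :: "nat \<Rightarrow> nat \<Rightarrow> nat list \<Rightarrow> nat list \<Rightarrow> bool" where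
  "W_adj s t x y \<longleftrightarrow>
     (\<forall>i<t. \<bar>int (x ! i) - int (y ! i)\<bar> = 1 \<or> (x ! i = y ! i \<and> y ! i = s))"

definition W :: "nat \<Rightarrow> nat \<Rightarrow> nat list pair_pre_digraph" where
  "W s t = \<lparr> pverts = W_verts s t,
             parcs = {(x, y). x \<in> W_verts s t \<and> y \<in> W_verts s t \<and> W_adj s t x y} \<rparr>"

lemma pair_graph_W:
  assumes "s \<ge> 1"
  shows "pair_graph (W s t)"
proof -
  have "W_verts s t \<subseteq> {x. set x \<subseteq> {0..s} \<and> length x = t}"
  proof
    fix x assume "x \<in> W_verts s t"
    then have "length x = t" "\<forall>i<t. x ! i \<in> {0..s}"
      unfolding W_verts_def by blast+
    then show "x \<in> {x. set x \<subseteq> {0..s} \<and> length x = t}"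
      unfolding set_conv_nth by blast
  qed
  then have fin: "finite (W_verts s t)"
    by (rule finite_subset) (rule finite_lists_length_eq, simp)
  have fin_arcs: "finite (parcs (W s t))"
    by (rule finite_subset[of _ "W_verts s t \<times> W_verts s t"]) (auto simp: W_def fin)
  have sym: "W_adj s t y x" if "W_adj s t x y" for x y
    unfolding W_adj_def
  proof (intro allI impI)
    fix i assume "i < t"
    with that have "\<bar>int (x ! i) - int (y ! i)\<bar> = 1 \<or> (x ! i = y ! i \<and> y ! i = s)"
      unfolding W_adj_def by blast
    then show "\<bar>int (y ! i) - int (x ! i)\<bar> = 1 \<or> (y ! i = x ! i \<and> x ! i = s)"
      by linarith
  qed
  have irrefl: "\<not> W_adj s t x x" if "x \<in> W_verts s t" for x
  proof
    assume adj: "W_adj s t x x"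
    obtain i where "i < t" "x ! i = 0" using \<open>x \<in> W_verts s t\<close> unfolding W_verts_def by blast
    with adj assms show False unfolding W_adj_def by simp
  qed
  show ?thesis
  proof unfold_locales
    show "finite (pverts (W s t))" "finite (parcs (W s t))"
      using fin fin_arcs by (simp_all add: W_def)
    show "symmetric (with_proj (W s t))"
      using sym by (simp add: symmetric_def sym_def W_def)
    fix e assume "e \<in> parcs (W s t)"
    then obtain x y where "e = (x, y)" "x \<in> W_verts s t" "y \<in> W_verts s t" "W_adj s t x y"
      by (auto simp: W_def)
    then show "fst e \<in> pverts (W s t)" "snd e \<in> pverts (W s t)" "fst e \<noteq> snd e"
      using irrefl by (auto simp: W_def)
  qed
qed

definition multicoloring ::
    "nat \<Rightarrow> nat \<Rightarrow> 'a pair_pre_digraph \<Rightarrow> ('a \<Rightarrow> nat set) \<Rightarrow> bool" where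
  "multicoloring r n G c \<longleftrightarrow>
     (\<forall>v \<in> pverts G. c v \<subseteq> {1..n} \<and> card (c v) = r) \<and>
     (\<forall>(u, v) \<in> parcs G. c u \<inter> c v = {})"

definition multichromatic_number :: "nat \<Rightarrow> 'a pair_pre_digraph \<Rightarrow> nat" where
  "multichromatic_number r G = (LEAST n. \<exists>c. multicoloring r n G c)"

text \<open>The minimum is taken over a nonempty set for every finite simple graph.\<close>

lemma multicoloring_exists:
  assumes "pair_graph G"
  shows "\<exists>n c. multicoloring r n G c"
proof -
  interpret pair_graph G by fact
  obtain f :: "'a \<Rightarrow> nat" and m where f: "f ` pverts G = {i. i < m}" "inj_on f (pverts G)"
    using finite_imp_inj_to_nat_seg[OF pair_finite_verts] by metis
  define c where "c v = {r * f v + 1..r * f v + r}" for v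
  have sub: "c v \<subseteq> {1..r * m}" if "v \<in> pverts G" for v
  proof -
    have "f v < m" using f(1) that by blast
    then have "r * (f v + 1) \<le> r * m" by (intro mult_le_mono2) simp
    then show ?thesis by (auto simp: c_def)
  qed
  have less: "c u \<inter> c v = {}" if "f u < f v" for u v
  proof -
    have "r * (f u + 1) \<le> r * f v" using that by (intro mult_le_mono2) simp
    then show ?thesis by (auto simp: c_def)
  qed
  have "c u \<inter> c v = {}" if "(u, v) \<in> parcs G" for u v
  proof -
    have "f u \<noteq> f v"
      using that pair_no_loops[OF that] in_arcsD1[OF that] in_arcsD2[OF that] f(2)
      by (auto dest: inj_onD)
    then show ?thesis using less[of u v] less[of v u] by (metis Int_commute nat_neq_iff)
  qed
  then have "multicoloring r (r * m) G c"
    using sub by (auto simp: multicoloring_def c_def)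
  then show ?thesis by blast
qed

end

theory Submission
  imports Defs
begin

text \<open>
  Upper bound. For \<open>k < s\<close> let \<open>j\<close> be the last index with \<open>x\<^sub>j \<le> k\<close> and give \<open>x\<close> the colour
  \<open>j + 2 * k\<close>, lowered by one if \<open>x\<^sub>j + k\<close> is odd. These \<open>s\<close> colours increase with \<open>k\<close>, and a
  colour shared by two adjacent vertices would force some pair of their entries to differ by
  at least two or to have the same parity.

  Lower bound. Colouring the \<open>s\<close>-subsets of \<open>{1..n}\<close> by their minimum, truncated as in Kneser's
  upper bound, turns an \<open>s\<close>-fold colouring with \<open>t + 2 * (s - 1) - 1\<close> colours into a proper
  colouring with \<open>t - 1\<close> colours. That this is impossible is a mod 2 version of the Borsuk-Ulam
  argument for the complex of signed vertices (complete bipartite subgraphs). Fan's alternating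
  cochains of a colouring with \<open>k + 1\<close> colours show that the index is at most \<open>k\<close>. Conversely,
  appending an entry \<open>s\<close> embeds the complex for \<open>t\<close> into the one for \<open>t + 1\<close> equivariantly and
  null-homotopically, so the index grows by at least one with each step of \<open>t\<close>.
\<close>

section \<open>The upper bound\<close>

definition last_le :: "nat list \<Rightarrow> nat \<Rightarrow> nat" where
  "last_le x k = Max {j. j < length x \<and> x ! j \<le> k}"

definition colour :: "nat list \<Rightarrow> nat \<Rightarrow> nat" where
  "colour x k = last_le x k + 2 * k - (if even (x ! last_le x k + k) then 0 else 1)"

lemma last_le:
  assumes "x \<in> W_verts s t"
  shows "last_le x k < t" "x ! last_le x k \<le> k" "i < t \<Longrightarrow> x ! i \<le> k \<Longrightarrow> i \<le> last_le x k"
proof -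
  let ?J = "{j. j < length x \<and> x ! j \<le> k}"
  have len: "length x = t" using assms by (simp add: W_verts_def)
  have fin: "finite ?J" by simp
  obtain j where "j < t" "x ! j = 0" using assms unfolding W_verts_def by blast
  then have "?J \<noteq> {}" using len by auto
  from Max_in[OF fin this] show "last_le x k < t" "x ! last_le x k \<le> k"
    unfolding last_le_def len[symmetric] by blast+
  show "i \<le> last_le x k" if "i < t" "x ! i \<le> k"
    unfolding last_le_def using that len by (intro Max_ge[OF fin]) simp
qed

lemma colour_eq:
  assumes "x \<in> W_verts s t"
  obtains p where "p \<le> 1" "colour x k + p = last_le x k + 2 * k" "even (x ! last_le x k + k + p)"
proof (cases "even (x ! last_le x k + k)")
  case True
  then show ?thesis using that[of 0] by (simp add: colour_def)
next
  case False
  \<comment> \<open>For \<open>k = 0\<close> the chosen entry is \<open>0\<close>, so this odd case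
    has \<open>k > 0\<close> and the truncated subtraction in \<open>colour\<close> is
    exact.\<close>
  then have "k > 0" using last_le(2)[OF assms, of k] by (cases k) auto
  then show ?thesis using False that[of 1] by (simp add: colour_def)
qed

text \<open>Each step in \<open>k\<close> raises \<open>last_le x k + 2 * k\<close> by at least two,
  while the parity correction removes at most one.\<close>

lemma colour_less:
  assumes x: "x \<in> W_verts s t" and "k < l"
  shows "colour x k < colour x l"
proof -
  have "last_le x k \<le> last_le x l"
    using last_le[OF x, of k] \<open>k < l\<close> by (intro last_le(3)[OF x]) auto
  moreover obtain p where "colour x k + p = last_le x k + 2 * k"
    using colour_eq[OF x] by blast
  moreover obtain q where "q \<le> 1" "colour x l + q = last_le x l + 2 * l"
    using colour_eq[OF x] by blast
  ultimately show ?thesis using \<open>k < l\<close> by linarith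
qed

text \<open>Compare the two last indices. If they agree, the entries there have equal parity yet
  must differ by one. If not, then \<open>k = l\<close> and the parity correction pushes the entry
  at the larger index strictly below \<open>k\<close>; the other vertex's entry there is at most
  \<open>k\<close>, against the choice of the smaller index.\<close>

lemma colour_neq:
  assumes x: "x \<in> W_verts s t" and y: "y \<in> W_verts s t" and adj: "W_adj s t x y"
    and "k \<le> l" "l < s"
  shows "colour x k \<noteq> colour y l"
proof
  assume eq: "colour x k = colour y l"
  let ?i = "last_le x k" and ?j = "last_le y l"
  obtain p where p: "p \<le> 1" "colour x k + p = ?i + 2 * k" "even (x ! ?i + k + p)"
    using colour_eq[OF x] .
  obtain q where q: "q \<le> 1" "colour y l + q = ?j + 2 * l" "even (y ! ?j + l + q)"
    using colour_eq[OF y] .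
  have adj': "\<bar>int (x ! i) - int (y ! i)\<bar> = 1 \<or> (x ! i = y ! i \<and> y ! i = s)" if "i < t" for i
    using adj that by (simp add: W_adj_def)
  have sum: "?i + 2 * k + q = ?j + 2 * l + p" using eq p q by linarith
  note xi = last_le[OF x, where k = k] and yj = last_le[OF y, where k = l]
  consider "?i < ?j" | "?i = ?j" | "?j < ?i" by linarith
  then show False
  proof cases
    case 1
    then have "k = l" "q = 1" "p = 0" using sum \<open>k \<le> l\<close> p(1) q(1) by linarith+
    then have "y ! ?j < l" using q(3) yj(2) by (cases "y ! ?j = l") auto
    then have "x ! ?j \<le> k" using adj'[OF yj(1)] \<open>k = l\<close> \<open>l < s\<close> by linarith
    from xi(3)[OF yj(1) this] 1 show False by simp
  next
    case 2
    then have "k = l" using sum \<open>k \<le> l\<close> p(1) q(1) by linarith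
    then have "p = q" using sum 2 by simp
    have "\<bar>int (x ! ?i) - int (y ! ?i)\<bar> = 1"
      using adj'[OF xi(1)] xi(2) \<open>k = l\<close> \<open>l < s\<close> by auto
    then have "x ! ?i = Suc (y ! ?i) \<or> y ! ?i = Suc (x ! ?i)" by linarith
    then show False using p(3) q(3) 2 \<open>k = l\<close> \<open>p = q\<close> by auto
  next
    case 3
    then have "y ! ?i > l" using yj(3)[OF xi(1)] by linarith
    then have "k = l" using adj'[OF xi(1)] xi(2) \<open>k \<le> l\<close> \<open>l < s\<close> by linarith
    then have "p = 1" "q = 0" using sum 3 p(1) q(1) by linarith+
    then have "x ! ?i < k" using p(3) xi(2) by (cases "x ! ?i = k") auto
    then show False using \<open>y ! ?i > l\<close> adj'[OF xi(1)] \<open>k = l\<close> \<open>l < s\<close> by linarith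
  qed
qed

lemma W_adj_sym: "W_adj s t x y \<Longrightarrow> W_adj s t y x"
  unfolding W_adj_def by fastforce

lemma multicoloring_upper:
  "multicoloring s (t + 2 * (s - 1)) (W s t) (\<lambda>x. (\<lambda>k. Suc (colour x k)) ` {..<s})"
proof -
  define c where "c x = (\<lambda>k. Suc (colour x k)) ` {..<s}" for x
  have "c x \<subseteq> {1..t + 2 * (s - 1)}" if x: "x \<in> W_verts s t" for x
  proof -
    have "Suc (colour x k) \<le> t + 2 * (s - 1)" if "k < s" for k
    proof -
      have "colour x k \<le> last_le x k + 2 * k" by (simp add: colour_def)
      then show ?thesis using last_le(1)[OF x, of k] that by linarith
    qed
    then show ?thesis unfolding c_def by auto
  qed
  moreover have "card (c x) = s" if "x \<in> W_verts s t" for x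
  proof -
    have "inj_on (\<lambda>k. Suc (colour x k)) {..<s}"
      using colour_less[OF that] by (intro inj_onI) (metis Suc_inject less_irrefl nat_neq_iff)
    then show ?thesis by (simp add: c_def card_image)
  qed
  moreover have "c x \<inter> c y = {}"
    if "x \<in> W_verts s t" "y \<in> W_verts s t" "W_adj s t x y" for x y
  proof -
    have "colour x k \<noteq> colour y l" if "k < s" "l < s" for k l
      using colour_neq[OF \<open>x \<in> _\<close> \<open>y \<in> _\<close> \<open>W_adj s t x y\<close>, of k l] that
        colour_neq[OF \<open>y \<in> _\<close> \<open>x \<in> _\<close> W_adj_sym[OF \<open>W_adj s t x y\<close>], of l k]
      by (cases "k \<le> l") auto
    then show ?thesis unfolding c_def by blast
  qed
  ultimately have "multicoloring s (t + 2 * (s - 1)) (W s t) c"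
    by (simp add: multicoloring_def W_def)
  then show ?thesis by (simp add: c_def[abs_def])
qed

section \<open>From multicolourings to colourings\<close>

text \<open>Disjoint sets cannot share a minimum, and \<open>{m..n}\<close> is too small to contain
  two disjoint \<open>s\<close>-sets.\<close>

lemma Kneser_colouring:
  fixes A B :: "nat set"
  assumes "A \<subseteq> {1..n}" "B \<subseteq> {1..n}" "card A = s" "card B = s" "A \<inter> B = {}"
    and "s \<ge> 1" "n + 1 < m + 2 * s"
  shows "min (Min A) m \<noteq> min (Min B) m"
proof
  assume eq: "min (Min A) m = min (Min B) m"
  have fin: "finite A" "finite B" using assms(1,2) finite_subset by blast+
  have ne: "A \<noteq> {}" "B \<noteq> {}" using assms(3,4,6) by auto
  have "Min A \<noteq> Min B" using Min_in[OF fin(1) ne(1)] Min_in[OF fin(2) ne(2)] assms(5) by auto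
  then have ge: "Min A \<ge> m" "Min B \<ge> m" using eq by linarith+
  have "A \<subseteq> {m..n}" "B \<subseteq> {m..n}"
    using ge assms(1,2) Min_le[OF fin(1)] Min_le[OF fin(2)] by fastforce+
  then have "card (A \<union> B) \<le> Suc n - m"
    using card_mono[of "{m..n}" "A \<union> B"] by simp
  moreover have "card (A \<union> B) = 2 * s" using card_Un_disjoint[OF fin assms(5)] assms(3,4) by simp
  ultimately show False using assms(6,7) by linarith
qed

section \<open>Coboundaries modulo 2\<close>

text \<open>Cochains live on ordered lists with repetitions, and \<open>\<noteq>\<close> is addition
  mod 2. The recursion separates deletion of the head from deletion of a later vertex.\<close>

fun cobdry :: "('a list \<Rightarrow> bool) \<Rightarrow> 'a list \<Rightarrow> bool" where
  "cobdry f [] = False"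
| "cobdry f (v # \<sigma>) = (f \<sigma> \<noteq> cobdry (\<lambda>l. f (v # l)) \<sigma>)"

lemma cobdry_cong:
  assumes "\<And>l. set l \<subseteq> set \<sigma> \<Longrightarrow> length \<sigma> = Suc (length l) \<Longrightarrow> f l = g l"
  shows "cobdry f \<sigma> = cobdry g \<sigma>"
  using assms
proof (induction \<sigma> arbitrary: f g)
  case (Cons v \<sigma>)
  have "f \<sigma> = g \<sigma>" using Cons.prems by auto
  moreover have "cobdry (\<lambda>l. f (v # l)) \<sigma> = cobdry (\<lambda>l. g (v # l)) \<sigma>"
    by (rule Cons.IH) (auto intro!: Cons.prems)
  ultimately show ?case by simp
qed simp

lemma cobdry_False: "\<not> cobdry (\<lambda>_. False) \<sigma>"
  by (induction \<sigma>) auto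

lemma cobdry_xor: "cobdry (\<lambda>l. f l \<noteq> g l) \<sigma> = (cobdry f \<sigma> \<noteq> cobdry g \<sigma>)"
proof (induction \<sigma> arbitrary: f g)
  case (Cons v \<sigma>)
  show ?case using Cons.IH[of "\<lambda>l. f (v # l)" "\<lambda>l. g (v # l)"] by auto
qed simp

lemma cobdry_map: "cobdry (\<lambda>l. f (map \<phi> l)) \<sigma> = cobdry f (map \<phi> \<sigma>)"
proof (induction \<sigma> arbitrary: f)
  case (Cons v \<sigma>)
  show ?case using Cons.IH[of "\<lambda>l. f (\<phi> v # l)"] by simp
qed simp

text \<open>Dual to the usual prism operator of the homotopy from \<open>\<phi>\<close> to \<open>\<psi>\<close>.\<close>

fun prism :: "('a \<Rightarrow> 'b) \<Rightarrow> ('a \<Rightarrow> 'b) \<Rightarrow> ('b list \<Rightarrow> bool) \<Rightarrow> 'a list \<Rightarrow> bool" where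
  "prism \<phi> \<psi> f [] = False"
| "prism \<phi> \<psi> f (v # \<sigma>) =
     (f (\<phi> v # \<psi> v # map \<psi> \<sigma>) \<noteq> prism \<phi> \<psi> (\<lambda>l. f (\<phi> v # l)) \<sigma>)"

lemma prism_xor: "prism \<phi> \<psi> (\<lambda>l. f l \<noteq> g l) \<sigma> = (prism \<phi> \<psi> f \<sigma> \<noteq> prism \<phi> \<psi> g \<sigma>)"
proof (induction \<sigma> arbitrary: f g)
  case (Cons v \<sigma>)
  show ?case using Cons.IH[of "\<lambda>l. f (\<phi> v # l)" "\<lambda>l. g (\<phi> v # l)"] by auto
qed simp

text \<open>The homotopy formula, without signs. In the inductive step the mixed term
  \<open>f (\<phi> v # map \<psi> \<sigma>)\<close> cancels against the one from the induction
  hypothesis for \<open>?g\<close>.\<close>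

lemma cobdry_prism:
  "(cobdry (prism \<phi> \<psi> f) \<sigma> \<noteq> prism \<phi> \<psi> (cobdry f) \<sigma>) = (f (map \<phi> \<sigma>) \<noteq> f (map \<psi> \<sigma>))"
proof (induction \<sigma> arbitrary: f)
  case (Cons v \<sigma>)
  let ?g = "\<lambda>l. f (\<phi> v # l)"
  have 1: "cobdry (prism \<phi> \<psi> f) (v # \<sigma>) =
      (prism \<phi> \<psi> f \<sigma> \<noteq> (cobdry (\<lambda>l. f (\<phi> v # \<psi> v # l)) (map \<psi> \<sigma>) \<noteq> cobdry (prism \<phi> \<psi> ?g) \<sigma>))"
    by (simp only: cobdry.simps prism.simps cobdry_xor
        cobdry_map[of "\<lambda>l. f (\<phi> v # \<psi> v # l)" \<psi>])
  have 2: "prism \<phi> \<psi> (cobdry f) (v # \<sigma>) =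
      ((f (map \<psi> (v # \<sigma>)) \<noteq> (f (\<phi> v # map \<psi> \<sigma>) \<noteq> cobdry (\<lambda>l. f (\<phi> v # \<psi> v # l)) (map \<psi> \<sigma>)))
       \<noteq> (prism \<phi> \<psi> f \<sigma> \<noteq> prism \<phi> \<psi> (cobdry ?g) \<sigma>))"
    by (simp only: cobdry.simps prism.simps prism_xor list.map)
  show ?case using Cons.IH[of ?g] unfolding 1 2 list.map by argo
qed simp

lemma prism_False:
  assumes "\<And>l. set l \<subseteq> \<phi> ` set \<sigma> \<union> \<psi> ` set \<sigma> \<Longrightarrow> length l = Suc (length \<sigma>) \<Longrightarrow> \<not> f l"
  shows "\<not> prism \<phi> \<psi> f \<sigma>"
  using assms
proof (induction \<sigma> arbitrary: f)
  case (Cons v \<sigma>)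
  have "\<not> f (\<phi> v # \<psi> v # map \<psi> \<sigma>)" by (rule Cons.prems) auto
  moreover have "\<not> prism \<phi> \<psi> (\<lambda>l. f (\<phi> v # l)) \<sigma>"
  proof (rule Cons.IH)
    fix l assume "set l \<subseteq> \<phi> ` set \<sigma> \<union> \<psi> ` set \<sigma>" "length l = Suc (length \<sigma>)"
    then show "\<not> f (\<phi> v # l)" by (intro Cons.prems) auto
  qed
  ultimately show ?case by simp
qed simp

section \<open>Sign alternation\<close>

fun alternating :: "bool \<Rightarrow> bool list \<Rightarrow> bool" where
  "alternating b [] = True"
| "alternating b (p # ps) = (p = b \<and> alternating (\<not> b) ps)"

lemma alternating_Not: "alternating b (map Not ps) = alternating (\<not> b) ps"
  by (induction ps arbitrary: b) auto

text \<open>Count the deletions that leave a list alternating from \<open>b\<close>. If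
  \<open>ps\<close> alternates from \<open>b\<close>, only deleting the last entry works; if from
  \<open>\<not> b\<close>, only the first. Otherwise two neighbours are equal, and deleting either
  gives the same list, so the count is even.\<close>

lemma cobdry_alternating:
  "ps \<noteq> [] \<Longrightarrow> cobdry (alternating b) ps = (alternating b ps \<noteq> alternating (\<not> b) ps)"
proof (induction ps arbitrary: b)
  case (Cons p ps)
  show ?case
  proof (cases "ps = []")
    case False
    then have IH: "cobdry (alternating (\<not> b)) ps = (alternating (\<not> b) ps \<noteq> alternating b ps)"
      using Cons.IH[of "\<not> b"] by simp
    show ?thesis
    proof (cases "p = b")
      case True
      then show ?thesis using IH by simp argo
    next
      case False
      then show ?thesis using IH by (auto simp: cobdry_False)
    qed
  qed auto
qed simp

text \<open>One deletion removes \<open>v\<close>; the others commute with inserting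
  \<open>v\<close>, because \<open>\<rho>\<close> is sorted.\<close>

lemma cobdry_insort_key:
  assumes "sorted (map \<kappa> \<rho>)"
  shows "cobdry g (insort_key \<kappa> v \<rho>) = (g \<rho> \<noteq> cobdry (\<lambda>l. g (insort_key \<kappa> v l)) \<rho>)"
  using assms
proof (induction \<rho> arbitrary: g)
  case (Cons w \<rho>)
  show ?case
  proof (cases "\<kappa> v \<le> \<kappa> w")
    case True
    have ins: "insort_key \<kappa> v l = v # l" if "set l \<subseteq> set (w # \<rho>)" for l
      using that True Cons.prems by (cases l) fastforce+
    have "cobdry (\<lambda>l. g (insort_key \<kappa> v l)) (w # \<rho>) = cobdry (\<lambda>l. g (v # l)) (w # \<rho>)"
      by (rule cobdry_cong) (simp add: ins)
    then show ?thesis using True by simp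
  next
    case False
    then have "cobdry g (insort_key \<kappa> v (w # \<rho>)) =
        (g (insort_key \<kappa> v \<rho>) \<noteq> cobdry (\<lambda>l. g (w # l)) (insort_key \<kappa> v \<rho>))" by simp
    also have "cobdry (\<lambda>l. g (w # l)) (insort_key \<kappa> v \<rho>) =
        (g (w # \<rho>) \<noteq> cobdry (\<lambda>l. g (w # insort_key \<kappa> v l)) \<rho>)"
      using Cons by simp
    finally show ?thesis using False by simp argo
  qed
qed simp

lemma cobdry_sort_key: "cobdry (\<lambda>l. g (sort_key \<kappa> l)) \<sigma> = cobdry g (sort_key \<kappa> \<sigma>)"
proof (induction \<sigma> arbitrary: g)
  case (Cons v \<sigma>)
  have "cobdry (\<lambda>l. g (sort_key \<kappa> l)) (v # \<sigma>) =
      (g (sort_key \<kappa> \<sigma>) \<noteq> cobdry (\<lambda>l. g (insort_key \<kappa> v l)) (sort_key \<kappa> \<sigma>))"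
    using Cons[of "\<lambda>l. g (insort_key \<kappa> v l)"] by simp
  then show ?case by (simp add: cobdry_insort_key)
qed simp

lemma sort_key_map:
  assumes "\<And>u. u \<in> set \<sigma> \<Longrightarrow> \<kappa> (\<tau> u) = \<kappa> u"
  shows "sort_key \<kappa> (map \<tau> \<sigma>) = map \<tau> (sort_key \<kappa> \<sigma>)"
  using assms
proof (induction \<sigma>)
  case (Cons v \<sigma>)
  have "insort_key \<kappa> (\<tau> v) (map \<tau> \<rho>) = map \<tau> (insort_key \<kappa> v \<rho>)" if "set \<rho> \<subseteq> set \<sigma>" for \<rho>
    using that Cons.prems by (induction \<rho>) auto
  then show ?case using Cons by simp
qed simp

text \<open>Neighbours have opposite signs, hence different keys. This will bound the length of an
  alternating simplex by the number of colours.\<close>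

lemma alternating_strictly_sorted:
  fixes \<kappa> :: "'a \<Rightarrow> nat"
  assumes "sorted (map \<kappa> \<rho>)" "alternating b (map P \<rho>)"
    and "\<And>u v. u \<in> set \<rho> \<Longrightarrow> v \<in> set \<rho> \<Longrightarrow> \<kappa> u = \<kappa> v \<Longrightarrow> P u = P v"
  shows "distinct (map \<kappa> \<rho>)"
proof -
  have "sorted_wrt (<) (map \<kappa> \<rho>)"
    using assms
  proof (induction \<rho> arbitrary: b)
    case (Cons v \<rho>)
    have IH: "sorted_wrt (<) (map \<kappa> \<rho>)"
      by (rule Cons.IH[of "\<not> b"]) (use Cons.prems in auto)
    show ?case
    proof (cases \<rho>)
      case (Cons w \<rho>')
      have "P v \<noteq> P w" using Cons.prems(2) Cons by auto
      then have "\<kappa> v < \<kappa> w" using Cons.prems(1) Cons.prems(3)[of v w] Cons by force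
      then show ?thesis using IH Cons by auto
    qed simp
  qed simp
  then show ?thesis by (simp add: strict_sorted_iff)
qed

section \<open>Signed vertices\<close>

definition depth :: "nat \<Rightarrow> nat \<Rightarrow> nat" where
  "depth s x = min x (2 * s + 1 - x)"

text \<open>
  The bipartite double cover of \<^term>\<open>W s t\<close>: a signed vertex has all its entries in
  \<open>{0..2 * s + 1}\<close> and of the same parity, which is the sign, and \<^const>\<open>depth\<close> folds it to
  a vertex. Adjacency becomes \<^emph>\<open>all entries differ by exactly one\<close>, because the loop at \<open>s\<close>
  unfolds to the edge between \<open>s\<close> and \<open>s + 1\<close>.
\<close>

definition signed :: "nat \<Rightarrow> nat \<Rightarrow> nat list set" where
  "signed s t = {u. (\<forall>x\<in>set u. x \<le> 2 * s + 1 \<and> (even x \<longleftrightarrow> even (hd u))) \<and>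
     map (depth s) u \<in> W_verts s t}"

definition near :: "nat list \<Rightarrow> nat list \<Rightarrow> bool" where
  "near u v \<longleftrightarrow> list_all2 (\<lambda>x y. x = Suc y \<or> y = Suc x) u v"

text \<open>The deck involution of the double cover: \<open>2 * s + 1\<close> is odd, so the sign
  flips, while the depth of each entry is kept.\<close>

definition antipode :: "nat \<Rightarrow> nat list \<Rightarrow> nat list" where
  "antipode s u = map (\<lambda>x. 2 * s + 1 - x) u"

text \<open>Vertices of a single sign always span a simplex, as in the box complex that allows one
  side of the bipartite subgraph to be empty.\<close>

definition simplex :: "nat \<Rightarrow> nat \<Rightarrow> nat list list \<Rightarrow> bool" where
  "simplex s t \<sigma> \<longleftrightarrow> set \<sigma> \<subseteq> signed s t \<and>
     (\<forall>u\<in>set \<sigma>. \<forall>v\<in>set \<sigma>. even (hd u) \<and> odd (hd v) \<longrightarrow> near u v)"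

lemma near_sym: "near u v \<Longrightarrow> near v u"
  unfolding near_def by (induction u v rule: list_all2_induct) auto

lemma W_verts_iff:
  "x \<in> W_verts s t \<longleftrightarrow> length x = t \<and> set x \<subseteq> {..s} \<and> count_list x 0 = 1 \<and> 1 \<in> set x"
proof -
  have "count_list x 0 = card {i. i < length x \<and> x ! i = 0}"
    unfolding count_list_eq_length_filter length_filter_conv_card
    by (rule arg_cong[where f = card]) auto
  then have cnt: "count_list x 0 = 1 \<longleftrightarrow> (\<exists>!i. i < length x \<and> x ! i = 0)"
    using is_singleton_iff_ex1[of "{i. i < length x \<and> x ! i = 0}"]
    unfolding is_singleton_iff_card_eq_Suc_0 mem_Collect_eq One_nat_def by simp
  have all: "set x \<subseteq> {..s} \<longleftrightarrow> (\<forall>i<length x. x ! i \<in> {0..s})"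
    by (auto simp: set_conv_nth)
  have ex: "1 \<in> set x \<longleftrightarrow> (\<exists>j<length x. x ! j = 1)"
    by (auto simp: in_set_conv_nth)
  show ?thesis
  proof (cases "length x = t")
    case True
    show ?thesis unfolding W_verts_def cnt all ex True mem_Collect_eq by (rule refl)
  qed (simp add: W_verts_def)
qed

lemma count_list_map_eq:
  "(\<And>x. x \<in> set u \<Longrightarrow> f x = a \<longleftrightarrow> x = b) \<Longrightarrow> count_list (map f u) a = count_list u b"
  by (induction u) auto

lemma signed_iff:
  assumes "s \<ge> 1"
  shows "u \<in> signed s t \<longleftrightarrow> length u = t \<and>
    (\<forall>x\<in>set u. x \<le> 2 * s + 1 \<and> (even x \<longleftrightarrow> even (hd u))) \<and>
    (if even (hd u) then count_list u 0 = 1 \<and> 2 * s \<in> set u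
     else count_list u (2 * s + 1) = 1 \<and> 1 \<in> set u)"
proof (cases "\<forall>x\<in>set u. x \<le> 2 * s + 1 \<and> (even x \<longleftrightarrow> even (hd u))")
  case True
  \<comment> \<open>Depth \<open>0\<close> comes from \<open>0\<close> or \<open>2 * s + 1\<close>,
    depth \<open>1\<close> from \<open>1\<close> or \<open>2 * s\<close>; the sign selects one of
    the two.\<close>
  have "count_list (map (depth s) u) 0 = count_list u (if even (hd u) then 0 else 2 * s + 1)"
  proof (rule count_list_map_eq)
    fix x assume "x \<in> set u"
    then have "x \<le> 2 * s + 1" "even x \<longleftrightarrow> even (hd u)" using True by auto
    then show "depth s x = 0 \<longleftrightarrow> x = (if even (hd u) then 0 else 2 * s + 1)"
      unfolding depth_def by (auto simp: min_def; presburger)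
  qed
  moreover have "1 \<in> set (map (depth s) u) \<longleftrightarrow> (if even (hd u) then 2 * s else 1) \<in> set u"
  proof -
    have "1 = depth s x \<longleftrightarrow> x = (if even (hd u) then 2 * s else 1)" if "x \<in> set u" for x
    proof -
      have "x \<le> 2 * s + 1" "even x \<longleftrightarrow> even (hd u)" using that True by auto
      then show ?thesis using assms unfolding depth_def by (auto simp: min_def; presburger)
    qed
    then show ?thesis by (auto simp: image_iff)
  qed
  moreover have "set (map (depth s) u) \<subseteq> {..s}" by (auto simp: depth_def)
  ultimately show ?thesis using True by (simp add: signed_def W_verts_iff)
qed (auto simp: signed_def)

lemma signed_nonempty: "u \<in> signed s t \<Longrightarrow> u \<noteq> []"
  by (auto simp: signed_def W_verts_iff)

lemma signed_entry:
  assumes "u \<in> signed s t" "x \<in> set u"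
  shows "x \<le> 2 * s + 1" "even x \<longleftrightarrow> even (hd u)"
  using assms by (auto simp: signed_def)

lemma W_adj_depth:
  assumes "u \<in> signed s t" "v \<in> signed s t" "near u v"
  shows "W_adj s t (map (depth s) u) (map (depth s) v)"
  unfolding W_adj_def
proof (intro allI impI)
  fix i assume "i < t"
  then have i: "i < length u" "i < length v" using assms by (auto simp: signed_def W_verts_def)
  then have "u ! i = Suc (v ! i) \<or> v ! i = Suc (u ! i)" "u ! i \<le> 2 * s + 1" "v ! i \<le> 2 * s + 1"
    using assms by (auto simp: near_def list_all2_conv_all_nth signed_def)
  then show "\<bar>int (map (depth s) u ! i) - int (map (depth s) v ! i)\<bar> = 1 \<or>
      map (depth s) u ! i = map (depth s) v ! i \<and> map (depth s) v ! i = s"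
    using i unfolding depth_def by (auto simp: min_def; presburger)
qed

lemma hd_antipode:
  assumes "u \<in> signed s t"
  shows "even (hd (antipode s u)) \<longleftrightarrow> odd (hd u)"
  using signed_entry(1)[OF assms, of "hd u"] signed_nonempty[OF assms]
  by (simp add: antipode_def hd_map)

lemma depth_antipode:
  assumes "u \<in> signed s t"
  shows "map (depth s) (antipode s u) = map (depth s) u"
proof -
  have "depth s (2 * s + 1 - x) = depth s x" if "x \<in> set u" for x
    using signed_entry(1)[OF assms that] by (auto simp: depth_def min_def)
  then show ?thesis by (simp add: antipode_def)
qed

lemma antipode_signed:
  assumes "u \<in> signed s t"
  shows "antipode s u \<in> signed s t"
proof -
  have "x \<le> 2 * s + 1 \<and> (even x \<longleftrightarrow> even (hd (antipode s u)))" if "x \<in> set (antipode s u)" for x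
  proof -
    obtain y where y: "y \<in> set u" "x = 2 * s + 1 - y" using \<open>x \<in> _\<close> by (auto simp: antipode_def)
    then show ?thesis
      using signed_entry[OF assms y(1)] unfolding hd_antipode[OF assms] by auto
  qed
  moreover have "map (depth s) u \<in> W_verts s t" using assms by (simp add: signed_def)
  ultimately show ?thesis by (simp add: signed_def depth_antipode[OF assms])
qed

lemma near_antipode:
  assumes "u \<in> signed s t" "v \<in> signed s t" "near u v"
  shows "near (antipode s u) (antipode s v)"
proof -
  have "list_all2 (\<lambda>x y. (x = Suc y \<or> y = Suc x) \<and> x \<le> 2 * s + 1 \<and> y \<le> 2 * s + 1) u v"
    using assms(3) signed_entry(1)[OF assms(1)] signed_entry(1)[OF assms(2)]
    by (auto simp: near_def list_all2_conv_all_nth)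
  then show ?thesis
    unfolding near_def antipode_def list_all2_map1 list_all2_map2
    by (rule list_all2_mono) auto
qed

lemma simplex_antipode:
  assumes "simplex s t \<sigma>"
  shows "simplex s t (map (antipode s) \<sigma>)"
proof -
  have sub: "u \<in> signed s t" if "u \<in> set \<sigma>" for u using assms that by (auto simp: simplex_def)
  have "near (antipode s u) (antipode s v)"
    if "u \<in> set \<sigma>" "v \<in> set \<sigma>" "even (hd (antipode s u))" "odd (hd (antipode s v))" for u v
  proof -
    have "near v u"
      using assms that hd_antipode[OF sub[OF that(1)]] hd_antipode[OF sub[OF that(2)]]
      by (auto simp: simplex_def)
    then show ?thesis using near_antipode near_sym sub that(1,2) by metis
  qed
  then show ?thesis using antipode_signed sub by (auto simp: simplex_def)
qed

section \<open>Contracting the subcomplex in which the last entry is \<open>s\<close>\<close>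

text \<open>
  At level \<open>d\<close> the old entries are clipped from below by \<open>bound s d\<close> and \<open>top s d\<close> is the new
  last entry. High levels only append the fold point \<open>s\<close> (or \<open>s + 1\<close>), whereas on level \<open>0\<close>
  everything becomes a single vertex.
\<close>

definition bound :: "nat \<Rightarrow> nat \<Rightarrow> nat" where
  "bound s d = (if d \<le> 2 * s then 2 * s - d else d mod 2)"

definition top_entry :: "nat \<Rightarrow> nat \<Rightarrow> nat" where
  "top_entry s d = (if d \<le> 2 * s - 2 then d mod 2 else if d \<le> 3 * s - 2 then d - (2 * s - 2)
     else if even d \<longleftrightarrow> even s then s else Suc s)"

definition lift :: "nat \<Rightarrow> nat \<Rightarrow> nat list \<Rightarrow> nat list" where
  "lift s d u = map (max (bound s d)) u @ [top_entry s d]"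

text \<open>The level is rounded up to the parity of the vertex, so passing from
  \<open>Suc e\<close> to \<open>e\<close> moves only the vertices whose sign matches
  \<open>e\<close>, by two levels.\<close>

definition place :: "nat \<Rightarrow> nat \<Rightarrow> nat list \<Rightarrow> nat list" where
  "place s e u = lift s (if even (hd u) \<longleftrightarrow> even e then e else Suc e) u"

lemma even_bound: "even (bound s d) \<longleftrightarrow> even d"
  unfolding bound_def by auto

lemma bound_step: "bound s d = Suc (bound s (Suc d)) \<or> bound s (Suc d) = Suc (bound s d)"
  unfolding bound_def by (auto simp: mod_Suc) presburger+

lemma even_top_entry: "even (top_entry s d) \<longleftrightarrow> even d"
  unfolding top_entry_def by auto

text \<open>The new entry alternates between \<open>0\<close> and \<open>1\<close> up to level
  \<open>2 * s - 2\<close>, climbs to \<open>s\<close> at level \<open>3 * s - 2\<close>, then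
  alternates between \<open>s\<close> and \<open>Suc s\<close>.\<close>

lemma top_entry_step:
  assumes "s \<ge> 1"
  shows "top_entry s d = Suc (top_entry s (Suc d)) \<or> top_entry s (Suc d) = Suc (top_entry s d)"
proof -
  consider "d < 2 * s - 2" | "d = 2 * s - 2" | "2 * s - 2 < d" "d < 3 * s - 2"
    | "d = 3 * s - 2" "2 * s - 2 < d" | "3 * s - 2 < d" by linarith
  then show ?thesis
  proof cases
    case 1
    then show ?thesis by (auto simp: top_entry_def mod_Suc)
  next
    case 2
    then show ?thesis using assms by (auto simp: top_entry_def)
  next
    case 3
    then show ?thesis by (auto simp: top_entry_def)
  next
    case 4
    then show ?thesis using assms by (auto simp: top_entry_def)
  next
    case 5
    then show ?thesis using assms by (auto simp: top_entry_def)
  qed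
qed

lemma top_entry_le: "s \<ge> 1 \<Longrightarrow> top_entry s d \<le> Suc s"
  unfolding top_entry_def by auto

text \<open>On even levels below \<open>2 * s\<close> clipping destroys the old zero and the new
  entry supplies one; from \<open>2 * s\<close> on the old zero survives and the new entry is
  positive. On odd levels \<open>2 * s + 1\<close> is never clipped, and the required
  \<open>1\<close> is the new entry below \<open>2 * s\<close> and an old one above.\<close>

lemma lift_signed:
  assumes s: "s \<ge> 1" and u: "u \<in> signed s t" and par: "even (hd u) \<longleftrightarrow> even d"
  shows "lift s d u \<in> signed s (Suc t)" "even (hd (lift s d u)) \<longleftrightarrow> even d"
proof -
  obtain x u' where Cons: "u = x # u'" using signed_nonempty[OF u] by (cases u) auto
  note ent = signed_entry[OF u] and top = top_entry_le[OF s, of d]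
  have le: "bound s d \<le> 2 * s" using s by (auto simp: bound_def)
  show par': "even (hd (lift s d u)) \<longleftrightarrow> even d"
    using par even_bound[of s d] by (simp add: lift_def Cons max_def)
  have len: "length (lift s d u) = Suc t"
    using u by (simp add: lift_def signed_def W_verts_def)
  have ent': "\<forall>y\<in>set (lift s d u). y \<le> 2 * s + 1 \<and> (even y \<longleftrightarrow> even (hd (lift s d u)))"
    unfolding par' using ent le top even_bound[of s d] even_top_entry[of s d] par s
    by (auto simp: lift_def max_def)
  have cnt: "if even d then count_list u 0 = 1 \<and> 2 * s \<in> set u
      else count_list u (2 * s + 1) = 1 \<and> 1 \<in> set u"
    using u par unfolding signed_iff[OF s] by (cases "even d") simp_all
  have "if even d then count_list (lift s d u) 0 = 1 \<and> 2 * s \<in> set (lift s d u)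
      else count_list (lift s d u) (2 * s + 1) = 1 \<and> 1 \<in> set (lift s d u)"
  proof (cases "even d")
    case True
    have "2 * s \<in> set (lift s d u)"
      using cnt True le by (auto simp: lift_def image_iff intro!: bexI[of _ "2 * s"])
    moreover have "count_list (lift s d u) 0 = 1"
    proof (cases "d < 2 * s")
      case True
      then have "d \<le> 2 * s - 2" using \<open>even d\<close> by presburger
      then have "top_entry s d = 0" using \<open>even d\<close> by (simp add: top_entry_def)
      moreover have "count_list (map (max (bound s d)) u) 0 = 0"
        using True by (auto simp: count_list_0_iff bound_def max_def)
      ultimately show ?thesis by (simp add: lift_def)
    next
      case False
      then have "bound s d = 0" using \<open>even d\<close> by (auto simp: bound_def)
      moreover have "top_entry s d \<noteq> 0" using False s by (auto simp: top_entry_def)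
      moreover have "map (max 0) u = u" by (simp add: map_idI)
      ultimately show ?thesis using cnt \<open>even d\<close> by (simp add: lift_def)
    qed
    ultimately show ?thesis using True by simp
  next
    case False
    have "count_list (map (max (bound s d)) u) (2 * s + 1) = count_list u (2 * s + 1)"
      using le by (intro count_list_map_eq) (auto simp: max_def)
    moreover have "top_entry s d \<noteq> 2 * s + 1" using top s by linarith
    ultimately have "count_list (lift s d u) (2 * s + 1) = 1"
      using cnt False by (simp add: lift_def)
    moreover have "1 \<in> set (lift s d u)"
    proof (cases "d < 2 * s")
      case True
      have "top_entry s d = 1"
      proof (cases "d \<le> 2 * s - 2")
        case True
        then show ?thesis using \<open>odd d\<close> by (simp add: top_entry_def odd_iff_mod_2_eq_one)
      next
        case False
        then have "d = 2 * s - 1" using \<open>d < 2 * s\<close> by linarith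
        then show ?thesis using s by (auto simp: top_entry_def)
      qed
      then show ?thesis by (simp add: lift_def)
    next
      case False
      then have "bound s d \<le> 1" using \<open>odd d\<close> by (auto simp: bound_def)
      then show ?thesis
        using cnt \<open>odd d\<close> by (auto simp: lift_def image_iff max_def intro!: bexI[of _ 1])
    qed
    ultimately show ?thesis using False by simp
  qed
  then show "lift s d u \<in> signed s (Suc t)"
    unfolding signed_iff[OF s] using len ent' par' by simp
qed

lemma near_lift:
  assumes s: "s \<ge> 1" and u: "u \<in> signed s t" and v: "v \<in> signed s t" and "near u v"
    and par: "even (hd u) \<longleftrightarrow> even d" "even (hd v) \<longleftrightarrow> odd d"
  shows "near (lift s d u) (lift s (Suc d) v)"
proof -
  have "list_all2 (\<lambda>x y. (x = Suc y \<or> y = Suc x) \<and> (even x \<longleftrightarrow> even d) \<and> (even y \<longleftrightarrow> odd d)) u v"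
    using \<open>near u v\<close> signed_entry(2)[OF u] signed_entry(2)[OF v] par
    by (auto simp: near_def list_all2_conv_all_nth)
  then have "list_all2 (\<lambda>x y. max (bound s d) x = Suc (max (bound s (Suc d)) y) \<or>
      max (bound s (Suc d)) y = Suc (max (bound s d) x)) u v"
  proof (rule list_all2_mono)
    \<comment> \<open>Both arguments of \<open>max\<close> move by one, so the maxima differ by at
      most one; their opposite parities make it exactly one.\<close>
    fix x y
    assume xy: "(x = Suc y \<or> y = Suc x) \<and> (even x \<longleftrightarrow> even d) \<and> (even y \<longleftrightarrow> odd d)"
    then have "x \<noteq> Suc (bound s d)" "bound s d \<noteq> Suc x"
      using even_bound[of s d] by auto
    with xy show "max (bound s d) x = Suc (max (bound s (Suc d)) y) \<or>
        max (bound s (Suc d)) y = Suc (max (bound s d) x)"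
      using bound_step[of s d] unfolding max_def by (auto split: if_splits)
  qed
  then show ?thesis
    using top_entry_step[OF s, of d] by (simp add: near_def lift_def list_all2_map1 list_all2_map2
        list_all2_appendI)
qed

text \<open>Both placements together use only levels \<open>e\<close> to \<open>e + 2\<close>, so
  vertices of opposite sign sit on consecutive levels. Hence the prism stays inside the
  complex.\<close>

lemma simplex_place:
  assumes s: "s \<ge> 1" and \<sigma>: "simplex s t \<sigma>"
    and l: "set l \<subseteq> place s (Suc e) ` set \<sigma> \<union> place s e ` set \<sigma>"
  shows "simplex s (Suc t) l"
proof -
  have level: "\<exists>u\<in>set \<sigma>. \<exists>d. e \<le> d \<and> d \<le> e + 2 \<and> (even (hd u) \<longleftrightarrow> even d) \<and> w = lift s d u"
    if w: "w \<in> set l" for w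
  proof -
    obtain u e' where u: "u \<in> set \<sigma>" "e' = e \<or> e' = Suc e" "w = place s e' u" using w l by blast
    show ?thesis
      by (intro bexI[OF _ u(1)] exI[of _ "if even (hd u) \<longleftrightarrow> even e' then e' else Suc e'"])
        (use u in \<open>auto simp: place_def\<close>)
  qed
  have sub: "u \<in> signed s t" if "u \<in> set \<sigma>" for u using \<sigma> that by (auto simp: simplex_def)
  have "w \<in> signed s (Suc t)" if "w \<in> set l" for w
    using level[OF that] lift_signed(1)[OF s sub] by metis
  moreover have "near w w'" if w: "w \<in> set l" "w' \<in> set l" "even (hd w)" "odd (hd w')" for w w'
  proof -
    obtain u d where u: "u \<in> set \<sigma>" "e \<le> d" "d \<le> e + 2" "even (hd u) \<longleftrightarrow> even d" "w = lift s d u"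
      using level[OF w(1)] by blast
    obtain u' d' where u': "u' \<in> set \<sigma>" "e \<le> d'" "d' \<le> e + 2" "even (hd u') \<longleftrightarrow> even d'"
      "w' = lift s d' u'"
      using level[OF w(2)] by blast
    have d: "even d" "odd d'"
      using w(3,4) lift_signed(2)[OF s sub[OF u(1)] u(4)] lift_signed(2)[OF s sub[OF u'(1)] u'(4)]
        u(5) u'(5) by auto
    then have near: "near u u'" using \<sigma> u u' by (auto simp: simplex_def)
    have "d' = Suc d \<or> d = Suc d'" using d u(2,3) u'(2,3) by presburger
    then show ?thesis
      using near_lift[OF s sub[OF u(1)] sub[OF u'(1)] near, of d]
        near_lift[OF s sub[OF u'(1)] sub[OF u(1)] near_sym[OF near], of d'] near_sym
        u(4,5) u'(4,5) d by auto
  qed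
  ultimately show ?thesis by (auto simp: simplex_def)
qed

lemma place_0_even:
  assumes "u \<in> signed s t" "even (hd u)"
  shows "place s 0 u = replicate t (2 * s) @ [0]"
proof -
  have "max (2 * s) x = 2 * s" if "x \<in> set u" for x
    using signed_entry[OF assms(1) that] assms(2) by (cases "x = 2 * s + 1") (auto simp: max_def)
  then have "map (max (2 * s)) u = map (\<lambda>_. 2 * s) u" by simp
  moreover have "length u = t" using assms(1) by (auto simp: signed_def W_verts_def)
  ultimately show ?thesis
    using assms(2) by (simp add: place_def lift_def bound_def top_entry_def map_replicate_const)
qed

lemma apex_signed:
  assumes "s \<ge> 1" "t \<ge> 1"
  shows "replicate t (2 * s) @ [0] \<in> signed s (Suc t)"
proof -
  have "count_list (replicate t (2 * s)) 0 = 0" using assms by (auto simp: count_list_0_iff)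
  moreover have "even (hd (replicate t (2 * s) @ [0]))" using assms by (cases t) auto
  ultimately show ?thesis unfolding signed_iff[OF assms(1)] using assms by auto
qed

text \<open>At \<open>e = 0\<close> even vertices become the apex, and odd ones have old entries
  \<open>2 * s - 1\<close> or \<open>2 * s + 1\<close>, adjacent to \<open>2 * s\<close>. The image
  therefore lies in a cone.\<close>

lemma simplex_apex:
  assumes s: "s \<ge> 1" and "t \<ge> 1" and \<sigma>: "simplex s t \<sigma>"
  shows "simplex s (Suc t) ((replicate t (2 * s) @ [0]) # map (place s 0) \<sigma>)"
proof -
  let ?w = "replicate t (2 * s) @ [0]"
  have base: "simplex s (Suc t) (map (place s 0) \<sigma>)"
    by (rule simplex_place[OF s \<sigma>, of _ 0]) auto
  have sub: "u \<in> signed s t" if "u \<in> set \<sigma>" for u using \<sigma> that by (auto simp: simplex_def)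
  have ev: "even (hd ?w)" using \<open>t \<ge> 1\<close> by (cases t) auto
  have "near ?w (place s 0 v)" if "v \<in> set \<sigma>" "odd (hd (place s 0 v))" for v
  proof -
    note v = sub[OF that(1)]
    have odd: "odd (hd v)" using place_0_even[OF v] that(2) ev by auto
    have "2 * s = Suc (max (2 * s - 1) x) \<or> max (2 * s - 1) x = Suc (2 * s)" if "x \<in> set v" for x
      using signed_entry[OF v that] odd s by (auto simp: max_def; presburger)
    moreover have "length v = t" using v by (auto simp: signed_def W_verts_def)
    ultimately have "near (replicate t (2 * s)) (map (max (2 * s - 1)) v)"
      by (auto simp: near_def list_all2_conv_all_nth)
    moreover have "top_entry s 1 = 1"
    proof (cases "s = 1")
      case False
      then have "1 \<le> 2 * s - 2" using s by linarith
      then show ?thesis by (simp add: top_entry_def)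
    qed (simp add: top_entry_def)
    then have "place s 0 v = map (max (2 * s - 1)) v @ [1]"
      using odd s by (simp add: place_def lift_def bound_def)
    ultimately show ?thesis
      by (simp add: near_def list_all2_appendI)
  qed
  then show ?thesis
    using base ev apex_signed[OF s \<open>t \<ge> 1\<close>] by (auto simp: simplex_def)
qed

text \<open>The pullback of a cocycle along a null-homotopic map is a coboundary: the cone gives a
  primitive at \<open>e = 0\<close>, and each further level adds a prism term.\<close>

lemma contraction:
  assumes s: "s \<ge> 1" and t: "t \<ge> 1"
    and f: "\<And>\<sigma>. simplex s (Suc t) \<sigma> \<Longrightarrow> length \<sigma> = Suc n \<Longrightarrow> \<not> cobdry f \<sigma>"
  shows "\<exists>g. \<forall>\<sigma>. simplex s t \<sigma> \<longrightarrow> length \<sigma> = n \<longrightarrow> cobdry g \<sigma> = f (map (place s e) \<sigma>)"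
proof (induction e)
  case 0
  let ?w = "replicate t (2 * s) @ [0]"
  have "cobdry (\<lambda>l. f (?w # map (place s 0) l)) \<sigma> = f (map (place s 0) \<sigma>)"
    if \<sigma>: "simplex s t \<sigma>" "length \<sigma> = n" for \<sigma>
    using f[OF simplex_apex[OF s t \<sigma>(1)]] \<sigma>(2) cobdry_map[of "\<lambda>l. f (?w # l)" "place s 0" \<sigma>]
    by simp
  then show ?case by blast
next
  case (Suc e)
  then obtain g where g: "\<And>\<sigma>. simplex s t \<sigma> \<Longrightarrow> length \<sigma> = n \<Longrightarrow>
      cobdry g \<sigma> = f (map (place s e) \<sigma>)" by blast
  let ?p = "prism (place s (Suc e)) (place s e)"
  have "cobdry (\<lambda>l. ?p f l \<noteq> g l) \<sigma> = f (map (place s (Suc e)) \<sigma>)"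
    if \<sigma>: "simplex s t \<sigma>" "length \<sigma> = n" for \<sigma>
  proof -
    have "\<not> ?p (cobdry f) \<sigma>"
      by (rule prism_False) (use f simplex_place[OF s \<sigma>(1)] \<sigma>(2) in auto)
    then show ?thesis
      unfolding cobdry_xor using g[OF \<sigma>] cobdry_prism[of "place s (Suc e)" "place s e" f \<sigma>] by auto
  qed
  then show ?case by (intro exI[of _ "\<lambda>l. ?p f l \<noteq> g l"]) simp
qed

text \<open>Level \<open>4 * s\<close> is even and so high that nothing is clipped; only
  \<open>s\<close> or \<open>Suc s\<close> is appended, and the antipode exchanges these
  two.\<close>

lemma place_antipode:
  assumes s: "s \<ge> 1" and u: "u \<in> signed s t"
  shows "place s (4 * s) (antipode s u) = antipode s (place s (4 * s) u)"
proof -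
  have eq: "place s (4 * s) v = v @ [if even (hd v) \<longleftrightarrow> even s then s else Suc s]"
    if v: "v \<in> signed s t" for v
  proof -
    have "map (max (bound s (4 * s + (if even (hd v) then 0 else 1)))) v = v"
    proof (rule map_idI)
      fix x assume "x \<in> set v"
      then have "even x \<longleftrightarrow> even (hd v)" using signed_entry[OF v] by blast
      then show "max (bound s (4 * s + (if even (hd v) then 0 else 1))) x = x"
        using s by (cases x) (auto simp: bound_def max_def)
    qed
    then show ?thesis using s by (auto simp: place_def lift_def top_entry_def)
  qed
  show ?thesis
    unfolding eq[OF u] eq[OF antipode_signed[OF u]] hd_antipode[OF u]
    by (auto simp: antipode_def)
qed

section \<open>The index of the complex of signed vertices\<close>

text \<open>
  \<open>f\<close> encodes one cochain for each dimension: on lists of length \<open>i + 1\<close> it is the \<open>i\<close>-th one.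
  Such a sequence is a mod 2 substitute for an equivariant map to the \<open>k\<close>-sphere.
\<close>

definition index_le :: "nat \<Rightarrow> nat \<Rightarrow> nat \<Rightarrow> bool" where
  "index_le s t k \<longleftrightarrow> (\<exists>f.
     (\<forall>u\<in>signed s t. f [u] \<noteq> f [antipode s u]) \<and>
     (\<forall>\<sigma>. simplex s t \<sigma> \<longrightarrow> 2 \<le> length \<sigma> \<longrightarrow> length \<sigma> \<le> k + 1 \<longrightarrow>
       cobdry f \<sigma> = (f \<sigma> \<noteq> f (map (antipode s) \<sigma>))) \<and>
     (\<forall>\<sigma>. simplex s t \<sigma> \<longrightarrow> length \<sigma> = k + 2 \<longrightarrow> \<not> cobdry f \<sigma>))"

text \<open>The cocycle \<open>f\<close> is constant along the path from \<open>?u\<close> over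
  \<open>?v\<close> to \<open>?w\<close>, but \<open>?w\<close> is the antipode of
  \<open>?u\<close>.\<close>

lemma not_index_le_base:
  assumes s: "s \<ge> 1"
  shows "\<not> index_le s 2 0"
proof
  assume "index_le s 2 0"
  then obtain f where f: "\<And>u. u \<in> signed s 2 \<Longrightarrow> f [u] \<noteq> f [antipode s u]"
      "\<And>\<sigma>. simplex s 2 \<sigma> \<Longrightarrow> length \<sigma> = 2 \<Longrightarrow> \<not> cobdry f \<sigma>"
    unfolding index_le_def by (auto simp: numeral_2_eq_2)
  let ?u = "[0, 2 * s]" and ?v = "[2 * s, 0]" and ?w = "[2 * s + 1, 1]"
  have mem: "?u \<in> signed s 2" "?v \<in> signed s 2" "?w \<in> signed s 2"
    unfolding signed_iff[OF s] using s by auto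
  have eq: "f [x] = f [y]" if "simplex s 2 [x, y]" for x y
    using f(2)[OF that] by simp
  have "simplex s 2 [?u, ?v]" "simplex s 2 [?v, ?w]"
    using mem by (auto simp: simplex_def near_def)
  then have "f [?u] = f [?w]" using eq by metis
  moreover have "antipode s ?u = ?w" by (simp add: antipode_def)
  ultimately show False using f(1)[OF mem(1)] by simp
qed

lemma index_le_pred:
  assumes s: "s \<ge> 1" and t: "t \<ge> 1" and "index_le s (Suc t) (Suc k)"
  shows "index_le s t k"
proof -
  obtain f where f: "\<And>u. u \<in> signed s (Suc t) \<Longrightarrow> f [u] \<noteq> f [antipode s u]"
      "\<And>\<sigma>. simplex s (Suc t) \<sigma> \<Longrightarrow> 2 \<le> length \<sigma> \<Longrightarrow> length \<sigma> \<le> k + 2 \<Longrightarrow>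
        cobdry f \<sigma> = (f \<sigma> \<noteq> f (map (antipode s) \<sigma>))"
      "\<And>\<sigma>. simplex s (Suc t) \<sigma> \<Longrightarrow> length \<sigma> = Suc (k + 2) \<Longrightarrow> \<not> cobdry f \<sigma>"
    using assms(3) unfolding index_le_def by auto
  let ?\<iota> = "place s (4 * s)" and ?\<tau> = "antipode s"
  obtain g where g: "\<And>\<sigma>. simplex s t \<sigma> \<Longrightarrow> length \<sigma> = k + 2 \<Longrightarrow> cobdry g \<sigma> = f (map ?\<iota> \<sigma>)"
    using contraction[where n = "k + 2" and f = f and e = "4 * s", OF s t f(3)] by blast
  \<comment> \<open>The top cochain of \<open>f\<close> pulls back to the coboundary of
    \<open>g\<close>. Adding \<open>g\<close> and its antipodal translate in dimension
    \<open>k\<close> makes the new top cochain closed; this correction is invariant under the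
    antipode, so \<open>antisym\<close> is unaffected.\<close>
  define h where "h \<sigma> = (f (map ?\<iota> \<sigma>) \<noteq> (length \<sigma> = k + 1 \<and> g \<sigma> \<noteq> g (map ?\<tau> \<sigma>)))" for \<sigma>
  have simplex_\<iota>: "simplex s (Suc t) (map ?\<iota> \<sigma>)" if "simplex s t \<sigma>" for \<sigma>
    by (rule simplex_place[OF s that, of _ "4 * s"]) auto
  have sub: "u \<in> signed s t" if "simplex s t \<sigma>" "u \<in> set \<sigma>" for u \<sigma>
    using that by (auto simp: simplex_def)
  have comm: "map ?\<iota> (map ?\<tau> \<sigma>) = map ?\<tau> (map ?\<iota> \<sigma>)" if "simplex s t \<sigma>" for \<sigma>
    using place_antipode[OF s sub[OF that]] by simp
  have invol: "map ?\<tau> (map ?\<tau> \<sigma>) = \<sigma>" if "simplex s t \<sigma>" for \<sigma>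
  proof -
    have "?\<tau> (?\<tau> u) = u" if "u \<in> set \<sigma>" for u
      using signed_entry(1)[OF sub[OF \<open>simplex s t \<sigma>\<close> that]]
      by (auto simp: antipode_def intro!: map_idI)
    then show ?thesis by (auto intro!: map_idI)
  qed
  have antisym: "(h \<sigma> \<noteq> h (map ?\<tau> \<sigma>)) = (f (map ?\<iota> \<sigma>) \<noteq> f (map ?\<tau> (map ?\<iota> \<sigma>)))"
    if "simplex s t \<sigma>" for \<sigma>
    unfolding h_def comm[OF that] invol[OF that] length_map by argo
  have single: "simplex s t [u]" if "u \<in> signed s t" for u
    using that by (auto simp: simplex_def)
  have "h [u] \<noteq> h [?\<tau> u]" if u: "u \<in> signed s t" for u
  proof -
    have "?\<iota> u \<in> signed s (Suc t)" using simplex_\<iota>[OF single[OF u]] by (auto simp: simplex_def)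
    then show ?thesis using antisym[OF single[OF u]] f(1)[of "?\<iota> u"] by simp
  qed
  moreover have "cobdry h \<sigma> = (h \<sigma> \<noteq> h (map ?\<tau> \<sigma>))"
    if \<sigma>: "simplex s t \<sigma>" "2 \<le> length \<sigma>" "length \<sigma> \<le> k + 1" for \<sigma>
  proof -
    have "cobdry h \<sigma> = cobdry (\<lambda>l. f (map ?\<iota> l)) \<sigma>"
      by (rule cobdry_cong) (use \<sigma>(3) in \<open>simp add: h_def\<close>)
    also have "\<dots> = cobdry f (map ?\<iota> \<sigma>)" by (rule cobdry_map)
    finally show ?thesis
      unfolding antisym[OF \<sigma>(1)] using f(2)[OF simplex_\<iota>[OF \<sigma>(1)]] \<sigma>(2,3) by simp
  qed
  moreover have "\<not> cobdry h \<sigma>" if \<sigma>: "simplex s t \<sigma>" "length \<sigma> = k + 2" for \<sigma>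
  proof -
    have "cobdry h \<sigma> = cobdry (\<lambda>l. f (map ?\<iota> l) \<noteq> (g l \<noteq> g (map ?\<tau> l))) \<sigma>"
      by (rule cobdry_cong) (use \<sigma>(2) in \<open>simp add: h_def\<close>)
    also have "\<dots> = (cobdry f (map ?\<iota> \<sigma>) \<noteq> (cobdry g \<sigma> \<noteq> cobdry g (map ?\<tau> \<sigma>)))"
      by (simp only: cobdry_xor cobdry_map)
    finally have "cobdry h \<sigma> = \<dots>" .
    moreover have "cobdry g (map ?\<tau> \<sigma>) = f (map ?\<tau> (map ?\<iota> \<sigma>))"
      using g[OF simplex_antipode[OF \<sigma>(1)]] \<sigma>(2) unfolding comm[OF \<sigma>(1)] by simp
    moreover have "cobdry f (map ?\<iota> \<sigma>) = (f (map ?\<iota> \<sigma>) \<noteq> f (map ?\<tau> (map ?\<iota> \<sigma>)))"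
      by (rule f(2)[OF simplex_\<iota>[OF \<sigma>(1)]]) (simp_all add: \<sigma>(2))
    ultimately show ?thesis using g[OF \<sigma>] by argo
  qed
  ultimately show ?thesis unfolding index_le_def by blast
qed

text \<open>Raising \<open>t\<close> by one raises the excluded index by one.\<close>

lemma not_index_le: "s \<ge> 1 \<Longrightarrow> \<not> index_le s (k + 2) k"
proof (induction k)
  case 0
  then show ?case using not_index_le_base by (simp add: numeral_2_eq_2)
next
  case (Suc k)
  then show ?case using index_le_pred[of s "k + 2" k] by auto
qed

text \<open>
  The witness is Fan's cochain of alternating simplices. It vanishes above dimension \<open>k\<close>
  since an alternating simplex with \<open>n\<close> vertices uses \<open>n\<close> different colours.
\<close>

lemma index_le_of_colouring:
  assumes col: "\<And>x. x \<in> W_verts s t \<Longrightarrow> col x \<in> {..k}"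
    and proper: "\<And>x y. x \<in> W_verts s t \<Longrightarrow> y \<in> W_verts s t \<Longrightarrow> W_adj s t x y \<Longrightarrow> col x \<noteq> col y"
  shows "index_le s t k"
proof -
  define \<kappa> where "\<kappa> u = (col (map (depth s) u) :: nat)" for u
  define P :: "nat list \<Rightarrow> bool" where "P u = even (hd u)" for u
  define f where "f \<sigma> = alternating True (map P (sort_key \<kappa> \<sigma>))" for \<sigma>
  have sub: "u \<in> signed s t" if "simplex s t \<sigma>" "u \<in> set \<sigma>" for u \<sigma>
    using that by (auto simp: simplex_def)
  have f_antipode: "f (map (antipode s) \<sigma>) = alternating False (map P (sort_key \<kappa> \<sigma>))"
    if \<sigma>: "simplex s t \<sigma>" for \<sigma>
  proof -
    have "sort_key \<kappa> (map (antipode s) \<sigma>) = map (antipode s) (sort_key \<kappa> \<sigma>)"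
      by (rule sort_key_map) (simp add: \<kappa>_def depth_antipode[OF sub[OF \<sigma>]])
    moreover have "map P (map (antipode s) (sort_key \<kappa> \<sigma>)) = map Not (map P (sort_key \<kappa> \<sigma>))"
      by (auto simp: P_def hd_antipode[OF sub[OF \<sigma>]])
    ultimately show ?thesis by (simp only: f_def alternating_Not not_True_eq_False)
  qed
  have bdry: "cobdry f \<sigma> = (f \<sigma> \<noteq> f (map (antipode s) \<sigma>))" if \<sigma>: "simplex s t \<sigma>" "\<sigma> \<noteq> []" for \<sigma>
  proof -
    have ne: "map P (sort_key \<kappa> \<sigma>) \<noteq> []" using \<sigma>(2) by (metis list.map_disc_iff set_empty set_sort)
    have "cobdry f \<sigma> = cobdry (\<lambda>l. alternating True (map P l)) (sort_key \<kappa> \<sigma>)"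
      unfolding f_def by (rule cobdry_sort_key)
    also have "\<dots> = cobdry (alternating True) (map P (sort_key \<kappa> \<sigma>))" by (rule cobdry_map)
    finally show ?thesis
      unfolding f_antipode[OF \<sigma>(1)] using cobdry_alternating[OF ne, of True] by (simp add: f_def)
  qed
  \<comment> \<open>Vertices of opposite sign in a simplex fold to adjacent vertices of
    \<open>W s t\<close>, whose colours differ.\<close>
  have same_sign: "P u = P v" if "simplex s t \<sigma>" "u \<in> set \<sigma>" "v \<in> set \<sigma>" "\<kappa> u = \<kappa> v" for \<sigma> u v
  proof (rule ccontr)
    assume "P u \<noteq> P v"
    then have "near u v" using that near_sym by (auto simp: simplex_def P_def)
    note uv = sub[OF that(1,2)] sub[OF that(1,3)]
    show False
      using proper[OF _ _ W_adj_depth[OF uv \<open>near u v\<close>]] uv that(4) by (simp add: \<kappa>_def signed_def)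
  qed
  have short: "length \<sigma> \<le> k + 1"
    if \<sigma>: "simplex s t \<sigma>" "alternating b (map P (sort_key \<kappa> \<sigma>))" for \<sigma> b
  proof -
    have "distinct (map \<kappa> (sort_key \<kappa> \<sigma>))"
    proof (rule alternating_strictly_sorted[OF _ \<sigma>(2)])
      fix u v assume "u \<in> set (sort_key \<kappa> \<sigma>)" "v \<in> set (sort_key \<kappa> \<sigma>)" "\<kappa> u = \<kappa> v"
      then show "P u = P v" unfolding set_sort by (rule same_sign[OF \<sigma>(1)])
    qed simp
    then have "length \<sigma> = card (set (map \<kappa> (sort_key \<kappa> \<sigma>)))"
      by (simp only: distinct_card length_map length_sort)
    also have "\<dots> \<le> card {..k}"
      using sub[OF \<sigma>(1)] col by (intro card_mono) (auto simp: \<kappa>_def signed_def)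
    finally show ?thesis by simp
  qed
  have "\<not> f \<sigma>" "\<not> f (map (antipode s) \<sigma>)" if "simplex s t \<sigma>" "length \<sigma> = k + 2" for \<sigma>
    unfolding f_antipode[OF that(1)] using that(2) by (auto simp: f_def dest: short[OF that(1)])
  moreover have "f [u] \<noteq> f [antipode s u]" if "u \<in> signed s t" for u
    using hd_antipode[OF that] by (simp add: f_def P_def)
  moreover have "cobdry f \<sigma> = (f \<sigma> \<noteq> f (map (antipode s) \<sigma>))"
    if "simplex s t \<sigma>" "2 \<le> length \<sigma>" for \<sigma>
    using bdry[OF that(1)] that(2) by fastforce
  moreover have "\<not> cobdry f \<sigma>" if "simplex s t \<sigma>" "length \<sigma> = k + 2" for \<sigma>
    using calculation(1,2)[OF that] bdry[OF that(1)] that(2) by fastforce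
  ultimately show ?thesis unfolding index_le_def by blast
qed

lemma multicoloring_lower:
  assumes "s \<ge> 1" "t \<ge> 2" and c: "multicoloring s n (W s t) c"
  shows "t + 2 * (s - 1) \<le> n"
proof (rule ccontr)
  assume "\<not> t + 2 * (s - 1) \<le> n"
  then have n: "n + 2 < t + 2 * s" using assms by linarith
  have c1: "c x \<subseteq> {1..n}" "card (c x) = s" if "x \<in> W_verts s t" for x
    using c that by (auto simp: multicoloring_def W_def)
  have c2: "c x \<inter> c y = {}" if "x \<in> W_verts s t" "y \<in> W_verts s t" "W_adj s t x y" for x y
    using c that by (auto simp: multicoloring_def W_def)
  have "index_le s t (t - 2)"
  proof (rule index_le_of_colouring)
    \<comment> \<open>Truncating at \<open>m = t - 1\<close> leaves the colours \<open>1\<close> to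
      \<open>t - 1\<close>, since minima are positive; the shift by one starts them at
      \<open>0\<close>.\<close>
    show "min (Min (c x)) (t - 1) - 1 \<in> {..t - 2}" for x by auto
    show "min (Min (c x)) (t - 1) - 1 \<noteq> min (Min (c y)) (t - 1) - 1"
      if xy: "x \<in> W_verts s t" "y \<in> W_verts s t" "W_adj s t x y" for x y
    proof -
      have pos: "Min (c z) \<ge> 1" if "z \<in> W_verts s t" for z
      proof -
        have "finite (c z)" "c z \<noteq> {}"
          using c1[OF that] \<open>s \<ge> 1\<close> by (auto intro: finite_subset)
        then have "Min (c z) \<in> c z" by (rule Min_in)
        then show ?thesis using c1(1)[OF that] by auto
      qed
      have "min (Min (c x)) (t - 1) \<noteq> min (Min (c y)) (t - 1)"
        using c1[OF xy(1)] c1[OF xy(2)] c2[OF xy] assms n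
        by (intro Kneser_colouring[of _ n _ s]) auto
      then show ?thesis using pos[OF xy(1)] pos[OF xy(2)] \<open>t \<ge> 2\<close> by linarith
    qed
  qed
  moreover have "t - 2 + 2 = t" using \<open>t \<ge> 2\<close> by simp
  ultimately show False using not_index_le[of s "t - 2"] \<open>s \<ge> 1\<close> by simp
qed

theorem theorem2:
  fixes s t :: nat
  assumes "s \<ge> 1" and "t \<ge> 2"
  shows "multichromatic_number s (W s t) = t + 2 * (s - 1)"
  unfolding multichromatic_number_def
proof (rule Least_equality)
  show "\<exists>c. multicoloring s (t + 2 * (s - 1)) (W s t) c" using multicoloring_upper by blast
  show "t + 2 * (s - 1) \<le> n" if "\<exists>c. multicoloring s n (W s t) c" for n
    using multicoloring_lower[OF assms] that by blast
qed

end
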